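(* Let $\alpha\in\mathbb R$. The inequality \[ \sup_{n\ge1}\Big|\frac1n\sum_{k=1}^nx_k\Big|n^\alpha\le A\sup_{n\ge1}\Big|\sum_{k=n}^\infty\frac{x_k}k\Big|n^\alpha \] holds for all $x\in\mathcal D(C^* )$ with \[ A=\begin{cases}1+2^{-\alpha},&\alpha\le0;\\ \dfrac{2-\alpha}{1-\alpha},&0<\alpha<1;\\ \infty,&\alpha\ge1.\end{cases} \] It holds for all nonnegative $x\in\mathcal D(C^* )$ with \[ A=\begin{cases}1,&\alpha\le0;\\ \dfrac1{1-\alpha},&0<\alpha<1;\\ \infty,&\alpha\ge1.\end{cases} \] In each case the constant $A$ is best possible (the least element of $[0,\infty]$ for which the inequality holds for all the indicated $x$).
   Context: Sequences are indexed by the positive integers; suprema take values in $[0,\infty]$. $\mathcal D(C^* )$ is the set of all real sequences $x$ for which $\sum_{k=1}^\infty\frac{x_k}k$ converges (possibly conditionally) in $\mathbb R$. Convention: $\infty\cdot0=0$. *)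

theory Defs
  imports Complex_Main "HOL-Library.Extended_Nonnegative_Real"
begin

text \<open>A sequence indexed by the positive integers is a function \<^typ>\<open>nat \<Rightarrow> real\<close> of which only the
  values at positive arguments are used; the value at 0 never enters. The interval from 0 to
  infinity is \<^typ>\<open>ennreal\<close>, where infinity times 0 is 0.\<close>

definition cesaro :: "(nat \<Rightarrow> real) \<Rightarrow> nat \<Rightarrow> real" where
  "cesaro x n = 1 / real n * (\<Sum>k=1..n. x k)"

definition copson :: "(nat \<Rightarrow> real) \<Rightarrow> nat \<Rightarrow> real" where
  "copson x n = (\<Sum>j. x (n + j) / real (n + j))"

text \<open>On \<^typ>\<open>real\<close>, \<^const>\<open>summable\<close> is convergence of the partial sums, possibly conditional.\<close>

definition copson_domain :: "(nat \<Rightarrow> real) set" where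
  "copson_domain = {x. summable (\<lambda>j. x (Suc j) / real (Suc j))}"

definition weighted_sup :: "real \<Rightarrow> (nat \<Rightarrow> real) \<Rightarrow> ennreal" where
  "weighted_sup \<alpha> y = (SUP n\<in>{1..}. ennreal (\<bar>y n\<bar> * real n powr \<alpha>))"

definition cesaro_copson_bound :: "(nat \<Rightarrow> real) set \<Rightarrow> real \<Rightarrow> ennreal \<Rightarrow> bool" where
  "cesaro_copson_bound S \<alpha> A \<longleftrightarrow>
     (\<forall>x\<in>S. weighted_sup \<alpha> (cesaro x) \<le> A * weighted_sup \<alpha> (copson x))"

definition best_cesaro_copson_bound :: "(nat \<Rightarrow> real) set \<Rightarrow> real \<Rightarrow> ennreal \<Rightarrow> bool" where
  "best_cesaro_copson_bound S \<alpha> A \<longleftrightarrow>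
     cesaro_copson_bound S \<alpha> A \<and> (\<forall>B. cesaro_copson_bound S \<alpha> B \<longrightarrow> A \<le> B)"

end

theory Submission
  imports Defs "HOL-Analysis.Harmonic_Numbers"
begin

text \<open>
  Write \<open>R n\<close> for the Copson tail \<open>\<Sum>k\<ge>n. x k / k\<close>. Since \<open>x k = k * (R k - R (k + 1))\<close>, summation by
  parts gives
  \<open>cesaro x n = (R 1 + \<dots> + R n) / n - R (n + 1)\<close> (\<open>cesaro_eq_mean_copson\<close>),
  and conversely every null sequence \<open>R\<close> is the tail sequence of some \<open>x\<close>
  (\<open>copson_of_difference\<close>). The inequality therefore concerns arbitrary null sequences \<open>R\<close>, and
  the values \<open>R 1, \<dots>, R (n + 1)\<close> can be chosen independently subject to
  \<open>\<bar>R k\<bar> \<le> M * k powr (- \<alpha>)\<close>. The weighted mean at \<open>n\<close> is largest when \<open>R k = M * k powr (- \<alpha>)\<close>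
  for \<open>k \<le> n\<close> and \<open>R (n + 1) = - M * (n + 1) powr (- \<alpha>)\<close>, where it equals \<open>M\<close> times
  \<open>n powr (\<alpha> - 1) * (\<Sum>k=1..n. k powr (- \<alpha>)) + (n / (n + 1)) powr \<alpha>\<close>.
  The best constant is the supremum of this expression over \<open>n\<close>.

  If \<open>x\<close> is nonnegative, then \<open>R (n + 1) \<ge> 0\<close>, so the negative term only helps and the second
  summand disappears. When \<open>\<alpha> \<ge> 0\<close>, cutting \<open>k powr (- \<alpha>)\<close> off after \<open>n\<close> leaves a decreasing sequence
  \<open>R\<close>, hence a nonnegative \<open>x\<close>; when \<open>\<alpha> < 0\<close> this still works for \<open>n = 1\<close>.

  It remains to find the suprema. The first summand is a Riemann sum of \<open>t powr (- \<alpha>)\<close> on the unit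
  interval. If \<open>\<alpha> \<le> 0\<close>, both summands are largest at \<open>n = 1\<close>, with values \<open>1\<close> and \<open>2 powr (- \<alpha>)\<close>.
  If \<open>0 < \<alpha> < 1\<close>, they are bounded by their limits \<open>1 / (1 - \<alpha>)\<close> and \<open>1\<close>. If \<open>\<alpha> \<ge> 1\<close>, the first one
  dominates the harmonic numbers and is unbounded.
\<close>

section \<open>The Cesaro means in terms of the Copson tails\<close>

lemma copson_domain_summable_tail:
  assumes "x \<in> copson_domain" "n \<ge> 1"
  shows "summable (\<lambda>j. x (n + j) / real (n + j))"
proof -
  obtain m where m: "n = Suc m" using assms(2) by (cases n) auto
  have "summable (\<lambda>j. x (Suc j) / real (Suc j))"
    using assms(1) by (simp add: copson_domain_def)
  then have "summable (\<lambda>j. x (Suc (j + m)) / real (Suc (j + m)))"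
    by (subst summable_iff_shift [where f = "\<lambda>j. x (Suc j) / real (Suc j)"])
  then show ?thesis by (simp add: m add.commute)
qed

lemma copson_step:
  assumes "x \<in> copson_domain" "n \<ge> 1"
  shows "x n = real n * (copson x n - copson x (n + 1))"
proof -
  have "copson x n = x n / real n + copson x (n + 1)"
    using suminf_split_head [OF copson_domain_summable_tail [OF assms]]
    by (simp add: copson_def)
  then show ?thesis using assms(2) by (simp add: field_simps)
qed

text \<open>Abel summation. It turns the inequality between two transforms of \<open>x\<close> into a statement about
  the tails alone.\<close>

lemma cesaro_eq_mean_copson:
  assumes x: "x \<in> copson_domain" and n: "n \<ge> 1"
  shows "cesaro x n = (\<Sum>k=1..n. copson x k) / real n - copson x (n + 1)"
proof -
  have "(\<Sum>k=1..n. x k) = (\<Sum>k=1..n. copson x k) - real n * copson x (n + 1)" for n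
  proof (induction n)
    case (Suc n)
    have "(\<Sum>k=1..Suc n. x k) = (\<Sum>k=1..n. x k) + real (Suc n) * (copson x (Suc n) - copson x (Suc n + 1))"
      using copson_step [OF x, of "Suc n"] by (subst sum.cl_ivl_Suc) simp
    then show ?case
      unfolding Suc.IH by (simp add: algebra_simps)
  qed simp
  then show ?thesis using n by (simp add: cesaro_def field_simps)
qed

text \<open>The series defining the tails of \<open>x\<close> telescopes, so any null sequence may be prescribed as the
  tail sequence. This is what makes the search for extremal sequences elementary.\<close>

lemma copson_of_difference:
  fixes r :: "nat \<Rightarrow> real"
  assumes r: "r \<longlonglongrightarrow> 0"
  defines "x \<equiv> (\<lambda>k. real k * (r k - r (k + 1)))"
  shows "x \<in> copson_domain" and "\<And>n. n \<ge> 1 \<Longrightarrow> copson x n = r n"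
proof -
  have sums: "(\<lambda>j. x (n + j) / real (n + j)) sums r n" if "n \<ge> 1" for n
  proof -
    have "(\<lambda>j. r (n + j)) \<longlonglongrightarrow> 0"
      using LIMSEQ_ignore_initial_segment [OF r, of n] by (simp add: add.commute)
    from telescope_sums' [OF this]
    have "(\<lambda>j. r (n + j) - r (n + Suc j)) sums r n" by simp
    moreover have "x (n + j) / real (n + j) = r (n + j) - r (n + Suc j)" for j
      using that by (simp add: x_def del: of_nat_add)
    ultimately show ?thesis by simp
  qed
  show "x \<in> copson_domain"
    using sums [of 1] by (auto simp: copson_domain_def sums_iff)
  show "copson x n = r n" if "n \<ge> 1" for n
    using sums [OF that] by (simp add: copson_def sums_iff)
qed

section \<open>Weighted suprema\<close>

lemma weighted_sup_le_ennreal_iff: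
  assumes "M \<ge> 0"
  shows "weighted_sup \<alpha> y \<le> ennreal M \<longleftrightarrow> (\<forall>n\<ge>1. \<bar>y n\<bar> * real n powr \<alpha> \<le> M)"
  using assms by (auto simp: weighted_sup_def SUP_le_iff)

lemma weighted_sup_ge:
  assumes "n \<ge> 1"
  shows "ennreal (\<bar>y n\<bar> * real n powr \<alpha>) \<le> weighted_sup \<alpha> y"
  unfolding weighted_sup_def using assms by (intro SUP_upper) auto

text \<open>For a finite positive constant, the extended suprema reduce to pointwise real estimates: an
  infinite right-hand side bounds everything, and a finite one is a real \<open>M\<close> controlling each
  tail.\<close>

lemma cesaro_copson_boundI:
  assumes A: "A > 0"
    and bound: "\<And>x M n. \<lbrakk>x \<in> S; M \<ge> 0; n \<ge> 1; \<And>k. k \<ge> 1 \<Longrightarrow> \<bar>copson x k\<bar> \<le> M * real k powr (- \<alpha>)\<rbrakk>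
          \<Longrightarrow> \<bar>cesaro x n\<bar> * real n powr \<alpha> \<le> A * M"
  shows "cesaro_copson_bound S \<alpha> (ennreal A)"
  unfolding cesaro_copson_bound_def
proof
  fix x assume x: "x \<in> S"
  show "weighted_sup \<alpha> (cesaro x) \<le> ennreal A * weighted_sup \<alpha> (copson x)"
  proof (cases "weighted_sup \<alpha> (copson x)")
    case (real M)
    have "\<bar>copson x k\<bar> \<le> M * real k powr (- \<alpha>)" if "k \<ge> 1" for k
    proof -
      have "\<bar>copson x k\<bar> * real k powr \<alpha> \<le> M"
        using weighted_sup_le_ennreal_iff [OF real(1), of \<alpha> "copson x"] real(2) that by simp
      then show ?thesis using that by (simp add: powr_minus field_simps)
    qed
    then have "weighted_sup \<alpha> (cesaro x) \<le> ennreal (A * M)"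
      using bound [OF x real(1)] A real(1) by (subst weighted_sup_le_ennreal_iff) auto
    then show ?thesis using A real by (simp add: ennreal_mult)
  next
    case top
    then show ?thesis using A by (simp add: ennreal_mult_top)
  qed
qed

text \<open>The product of infinity and 0 is 0, so the bound is not vacuous: if all Copson tails vanish, the
  Cesaro means must vanish too, which they do because the tails determine them.\<close>

lemma cesaro_copson_bound_infinity:
  assumes "S \<subseteq> copson_domain"
  shows "cesaro_copson_bound S \<alpha> \<infinity>"
  unfolding cesaro_copson_bound_def
proof
  fix x assume x: "x \<in> S"
  show "weighted_sup \<alpha> (cesaro x) \<le> \<infinity> * weighted_sup \<alpha> (copson x)"
  proof (cases "weighted_sup \<alpha> (copson x) = 0")
    case True
    then have zero: "copson x n = 0" if "n \<ge> 1" for n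
      using weighted_sup_le_ennreal_iff [of 0 \<alpha> "copson x"] that
      by (force simp: mult_le_0_iff)
    have "weighted_sup \<alpha> (cesaro x) \<le> ennreal 0"
      using x assms
      by (subst weighted_sup_le_ennreal_iff) (auto simp: cesaro_eq_mean_copson zero subset_iff)
    then show ?thesis by simp
  next
    case False
    then show ?thesis by (simp add: ennreal_top_mult)
  qed
qed

section \<open>Normalised power sums\<close>

text \<open>This is \<open>(1 / n) * (\<Sum>k=1..n. (k / n) powr (- \<alpha>))\<close>, the right-endpoint Riemann sum of
  \<open>t powr (- \<alpha>)\<close> on the unit interval. It measures the weighted mean of the largest admissible
  tails.\<close>

definition power_riemann_sum :: "real \<Rightarrow> nat \<Rightarrow> real" where
  "power_riemann_sum \<alpha> n = real n powr (\<alpha> - 1) * (\<Sum>k=1..n. real k powr (- \<alpha>))"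

lemma mean_times_powr:
  assumes "n \<ge> 1"
  shows "(\<Sum>k=1..n. M * real k powr (- \<alpha>)) / real n * real n powr \<alpha> = M * power_riemann_sum \<alpha> n"
  using assms by (simp add: power_riemann_sum_def powr_diff sum_distrib_left [symmetric])

lemma power_riemann_sum_le_1:
  assumes "\<alpha> \<le> 0" "n \<ge> 1"
  shows "power_riemann_sum \<alpha> n \<le> 1"
proof -
  have "(\<Sum>k=1..n. real k powr (- \<alpha>)) \<le> (\<Sum>k=1..n. real n powr (- \<alpha>))"
    using assms by (intro sum_mono powr_mono2) auto
  then have "power_riemann_sum \<alpha> n \<le> real n powr (\<alpha> - 1) * (real n * real n powr (- \<alpha>))"
    unfolding power_riemann_sum_def by (intro mult_left_mono) auto
  also have "\<dots> = 1" using assms by (simp add: powr_diff powr_minus)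
  finally show ?thesis .
qed

text \<open>The derivative \<open>(1 - \<alpha>) * t powr (- \<alpha>)\<close> of \<open>t powr (1 - \<alpha>)\<close> is decreasing, so the mean value
  theorem places the increment between the endpoint derivatives. Telescoping then compares the power
  sum with the integral from both sides.\<close>

lemma powr_increment_bounds:
  fixes \<alpha> :: real and k :: nat
  assumes "0 < \<alpha>" "\<alpha> < 1"
  shows "(1 - \<alpha>) * real (Suc k) powr (- \<alpha>) \<le> real (Suc k) powr (1 - \<alpha>) - real k powr (1 - \<alpha>)"
    and "k \<ge> 1 \<Longrightarrow> real (Suc k) powr (1 - \<alpha>) - real k powr (1 - \<alpha>) \<le> (1 - \<alpha>) * real k powr (- \<alpha>)"
proof -
  have mvt: "\<exists>z. real k < z \<and> z < real (Suc k) \<and>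
      real (Suc k) powr (1 - \<alpha>) - real k powr (1 - \<alpha>) = (1 - \<alpha>) * z powr (- \<alpha>)" if "k \<ge> 1"
  proof -
    have "((\<lambda>t. t powr (1 - \<alpha>)) has_real_derivative (1 - \<alpha>) * t powr (- \<alpha>)) (at t)"
      if "real k \<le> t" for t
      using that \<open>k \<ge> 1\<close> has_real_derivative_powr [of t "1 - \<alpha>"] by simp
    then show ?thesis
      using MVT2 [of "real k" "real (Suc k)" "\<lambda>t. t powr (1 - \<alpha>)" "\<lambda>t. (1 - \<alpha>) * t powr (- \<alpha>)"]
      by auto
  qed
  show "real (Suc k) powr (1 - \<alpha>) - real k powr (1 - \<alpha>) \<le> (1 - \<alpha>) * real k powr (- \<alpha>)"
    if k: "k \<ge> 1"
  proof -
    obtain z where "real k < z"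
      "real (Suc k) powr (1 - \<alpha>) - real k powr (1 - \<alpha>) = (1 - \<alpha>) * z powr (- \<alpha>)"
      using mvt k by blast
    then show ?thesis
      using assms k by (auto intro!: mult_left_mono powr_mono2')
  qed
  show "(1 - \<alpha>) * real (Suc k) powr (- \<alpha>) \<le> real (Suc k) powr (1 - \<alpha>) - real k powr (1 - \<alpha>)"
  proof (cases "k = 0")
    \<comment> \<open>The derivative is singular at 0, so this case is computed directly; it uses \<open>0 powr a = 0\<close>.\<close>
    case True
    then show ?thesis using assms by simp
  next
    case False
    then obtain z where "real k < z" "z < real (Suc k)"
      "real (Suc k) powr (1 - \<alpha>) - real k powr (1 - \<alpha>) = (1 - \<alpha>) * z powr (- \<alpha>)"
      using mvt by auto
    then show ?thesis
      using assms by (auto intro!: mult_left_mono powr_mono2')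
  qed
qed

lemma power_sum_bounds:
  assumes "0 < \<alpha>" "\<alpha> < 1"
  shows "(1 - \<alpha>) * (\<Sum>k=1..n. real k powr (- \<alpha>)) \<le> real n powr (1 - \<alpha>)"
    and "real (Suc n) powr (1 - \<alpha>) - 1 \<le> (1 - \<alpha>) * (\<Sum>k=1..n. real k powr (- \<alpha>))"
proof (induction n)
  case (Suc n)
  { case 1 show ?case
      using Suc(1) powr_increment_bounds(1) [OF assms, of n] by (simp add: distrib_left) }
  { case 2 show ?case
      using Suc(2) powr_increment_bounds(2) [OF assms, of "Suc n"] by (simp add: distrib_left) }
qed auto

lemma power_riemann_sum_le:
  assumes "0 < \<alpha>" "\<alpha> < 1" "n \<ge> 1"
  shows "power_riemann_sum \<alpha> n \<le> 1 / (1 - \<alpha>)"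
proof -
  have "(1 - \<alpha>) * power_riemann_sum \<alpha> n
      = real n powr (\<alpha> - 1) * ((1 - \<alpha>) * (\<Sum>k=1..n. real k powr (- \<alpha>)))"
    by (simp add: power_riemann_sum_def)
  also have "\<dots> \<le> real n powr (\<alpha> - 1) * real n powr (1 - \<alpha>)"
    using power_sum_bounds(1) [OF assms(1,2)] by (intro mult_left_mono) auto
  also have "\<dots> = 1" using assms by (simp add: powr_add [symmetric])
  finally show ?thesis using assms by (simp add: field_simps)
qed

lemma power_riemann_sum_tendsto:
  assumes "0 < \<alpha>" "\<alpha> < 1"
  shows "power_riemann_sum \<alpha> \<longlonglongrightarrow> 1 / (1 - \<alpha>)"
proof (rule tendsto_sandwich)
  show "\<forall>\<^sub>F n in sequentially. (1 - real n powr (\<alpha> - 1)) / (1 - \<alpha>) \<le> power_riemann_sum \<alpha> n"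
    using eventually_ge_at_top [of 1]
  proof eventually_elim
    case (elim n)
    have "real n powr (1 - \<alpha>) - 1 \<le> real (Suc n) powr (1 - \<alpha>) - 1"
      using assms by (auto intro: powr_mono2)
    also note power_sum_bounds(2) [OF assms]
    finally have "real n powr (\<alpha> - 1) * (real n powr (1 - \<alpha>) - 1)
        \<le> real n powr (\<alpha> - 1) * ((1 - \<alpha>) * (\<Sum>k=1..n. real k powr (- \<alpha>)))"
      by (rule mult_left_mono) auto
    then show ?case
      using assms elim
      by (simp add: power_riemann_sum_def field_simps powr_add [symmetric])
  qed
  show "\<forall>\<^sub>F n in sequentially. power_riemann_sum \<alpha> n \<le> 1 / (1 - \<alpha>)"
    using eventually_ge_at_top [of 1] by eventually_elim (rule power_riemann_sum_le [OF assms])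
  have "(\<lambda>n. real n powr (\<alpha> - 1)) \<longlonglongrightarrow> 0"
    using assms by (intro tendsto_neg_powr filterlim_real_sequentially) auto
  then have "(\<lambda>n. (1 - real n powr (\<alpha> - 1)) / (1 - \<alpha>)) \<longlonglongrightarrow> (1 - 0) / (1 - \<alpha>)"
    using assms by (intro tendsto_divide tendsto_diff tendsto_const) auto
  then show "(\<lambda>n. (1 - real n powr (\<alpha> - 1)) / (1 - \<alpha>)) \<longlonglongrightarrow> 1 / (1 - \<alpha>)"
    by simp
qed auto

lemma harm_le_power_riemann_sum:
  assumes "\<alpha> \<ge> 1"
  shows "harm n \<le> power_riemann_sum \<alpha> n"
  unfolding power_riemann_sum_def sum_distrib_left harm_def
proof (rule sum_mono)
  fix k assume k: "k \<in> {1..n}"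
  have "real k powr (\<alpha> - 1) * real k powr (- \<alpha>) \<le> real n powr (\<alpha> - 1) * real k powr (- \<alpha>)"
    using assms k by (intro mult_right_mono powr_mono2) auto
  moreover have "real k powr (\<alpha> - 1) * real k powr (- \<alpha>) = 1 / real k"
    using k powr_minus_divide [of "real k" 1] by (simp add: powr_add [symmetric])
  ultimately show "inverse (real k) \<le> real n powr (\<alpha> - 1) * real k powr (- \<alpha>)"
    by (simp add: inverse_eq_divide)
qed

lemma power_riemann_sum_unbounded:
  assumes "\<alpha> \<ge> 1"
  shows "\<exists>n\<ge>1. power_riemann_sum \<alpha> n > b"
proof -
  have "\<forall>\<^sub>F n in sequentially. b < harm n \<and> n \<ge> 1"
    using harm_at_top eventually_ge_at_top
    by (auto simp: filterlim_at_top_dense intro: eventually_conj)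
  then obtain n where n: "b < harm n" "n \<ge> 1"
    by (auto simp: eventually_sequentially)
  then show ?thesis
    using less_le_trans [OF n(1) harm_le_power_riemann_sum [OF assms]] by blast
qed

section \<open>Upper bounds\<close>

lemma abs_mean_copson_le:
  assumes "n \<ge> 1" "\<And>k. k \<ge> 1 \<Longrightarrow> \<bar>copson x k\<bar> \<le> M * real k powr (- \<alpha>)"
  shows "\<bar>(\<Sum>k=1..n. copson x k) / real n\<bar> * real n powr \<alpha> \<le> M * power_riemann_sum \<alpha> n"
proof -
  have "\<bar>\<Sum>k=1..n. copson x k\<bar> \<le> (\<Sum>k=1..n. M * real k powr (- \<alpha>))"
    by (rule order_trans [OF sum_abs]) (auto intro!: sum_mono assms(2))
  then have "\<bar>(\<Sum>k=1..n. copson x k) / real n\<bar> * real n powr \<alpha>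
      \<le> (\<Sum>k=1..n. M * real k powr (- \<alpha>)) / real n * real n powr \<alpha>"
    by (auto simp: abs_divide intro!: mult_right_mono divide_right_mono)
  then show ?thesis using mean_times_powr [OF assms(1)] by simp
qed

lemma abs_cesaro_le:
  assumes x: "x \<in> copson_domain" and n: "n \<ge> 1"
    and le: "\<And>k. k \<ge> 1 \<Longrightarrow> \<bar>copson x k\<bar> \<le> M * real k powr (- \<alpha>)"
  shows "\<bar>cesaro x n\<bar> * real n powr \<alpha>
      \<le> M * (power_riemann_sum \<alpha> n + (real n / real (n + 1)) powr \<alpha>)"
proof -
  have "\<bar>cesaro x n\<bar> * real n powr \<alpha>
      \<le> \<bar>(\<Sum>k=1..n. copson x k) / real n\<bar> * real n powr \<alpha> + \<bar>copson x (n + 1)\<bar> * real n powr \<alpha>"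
    unfolding cesaro_eq_mean_copson [OF x n] distrib_right [symmetric]
    by (intro mult_right_mono abs_triangle_ineq4) auto
  also have "\<bar>copson x (n + 1)\<bar> * real n powr \<alpha> \<le> M * real (n + 1) powr (- \<alpha>) * real n powr \<alpha>"
    using le [of "n + 1"] by (intro mult_right_mono) auto
  also have "\<dots> = M * (real n / real (n + 1)) powr \<alpha>"
    by (simp add: powr_divide powr_minus_divide)
  also note abs_mean_copson_le [OF n le]
  finally show ?thesis by (simp add: distrib_left)
qed

text \<open>For nonnegative \<open>x\<close>, both the Cesaro mean and the tail subtracted in \<open>cesaro_eq_mean_copson\<close> are
  nonnegative, so the mean of the tails alone already dominates the Cesaro mean.\<close>

lemma abs_cesaro_le_nonneg:
  assumes x: "x \<in> copson_domain" "\<forall>k\<ge>1. 0 \<le> x k" and n: "n \<ge> 1"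
    and le: "\<And>k. k \<ge> 1 \<Longrightarrow> \<bar>copson x k\<bar> \<le> M * real k powr (- \<alpha>)"
  shows "\<bar>cesaro x n\<bar> * real n powr \<alpha> \<le> M * power_riemann_sum \<alpha> n"
proof -
  have "0 \<le> copson x (n + 1)"
    unfolding copson_def using x(2) copson_domain_summable_tail [OF x(1), of "n + 1"]
    by (intro suminf_nonneg) auto
  moreover have "0 \<le> cesaro x n"
    unfolding cesaro_def using x(2) by (auto intro!: sum_nonneg divide_nonneg_nonneg)
  ultimately have "\<bar>cesaro x n\<bar> \<le> \<bar>(\<Sum>k=1..n. copson x k) / real n\<bar>"
    using cesaro_eq_mean_copson [OF x(1) n] by linarith
  then have "\<bar>cesaro x n\<bar> * real n powr \<alpha> \<le> \<bar>(\<Sum>k=1..n. copson x k) / real n\<bar> * real n powr \<alpha>"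
    by (rule mult_right_mono) auto
  also note abs_mean_copson_le [OF n le]
  finally show ?thesis .
qed

lemma shifted_ratio_powr_le:
  assumes "n \<ge> 1"
  shows "\<alpha> \<le> 0 \<Longrightarrow> (real n / real (n + 1)) powr \<alpha> \<le> 2 powr (- \<alpha>)"
    and "\<alpha> \<ge> 0 \<Longrightarrow> (real n / real (n + 1)) powr \<alpha> \<le> 1"
proof -
  assume "\<alpha> \<le> 0"
  then have "(real n / real (n + 1)) powr \<alpha> \<le> (1 / 2) powr \<alpha>"
    using assms by (intro powr_mono2') (auto simp: field_simps)
  then show "(real n / real (n + 1)) powr \<alpha> \<le> 2 powr (- \<alpha>)"
    by (simp add: powr_divide powr_minus_divide)
next
  assume "\<alpha> \<ge> 0"
  then show "(real n / real (n + 1)) powr \<alpha> \<le> 1"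
    using assms by (intro powr_le1) auto
qed

section \<open>Extremal sequences\<close>

text \<open>The tails saturate \<open>\<bar>R k\<bar> \<le> k powr (- \<alpha>)\<close> up to \<open>n\<close>. With \<open>s = 1\<close> the next one saturates it with the
  opposite sign, which maximises the Cesaro mean at \<open>n\<close> among all sequences. The choice \<open>s = 0\<close> is for
  nonnegative sequences, whose tails cannot be negative.\<close>

definition extremal_tail :: "real \<Rightarrow> real \<Rightarrow> nat \<Rightarrow> nat \<Rightarrow> real" where
  "extremal_tail \<alpha> s n k =
     (if k \<le> n then real k powr (- \<alpha>) else if k = n + 1 then - s * real k powr (- \<alpha>) else 0)"

definition extremal_seq :: "real \<Rightarrow> real \<Rightarrow> nat \<Rightarrow> nat \<Rightarrow> real" where
  "extremal_seq \<alpha> s n k = real k * (extremal_tail \<alpha> s n k - extremal_tail \<alpha> s n (k + 1))"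

lemma extremal_seq_copson:
  shows extremal_seq_domain: "extremal_seq \<alpha> s n \<in> copson_domain"
    and copson_extremal_seq: "k \<ge> 1 \<Longrightarrow> copson (extremal_seq \<alpha> s n) k = extremal_tail \<alpha> s n k"
proof -
  have "extremal_tail \<alpha> s n \<longlonglongrightarrow> 0"
    by (intro tendsto_eventually eventually_sequentiallyI [of "n + 2"])
      (auto simp: extremal_tail_def)
  from copson_of_difference [OF this]
  show "extremal_seq \<alpha> s n \<in> copson_domain"
    and "k \<ge> 1 \<Longrightarrow> copson (extremal_seq \<alpha> s n) k = extremal_tail \<alpha> s n k"
    by (simp_all add: extremal_seq_def [abs_def])
qed

text \<open>The sequence is nonnegative exactly when its tails decrease. For negative \<open>\<alpha>\<close> the tails
  \<open>k powr (- \<alpha>)\<close> increase, and only the single jump of \<open>n = 1\<close> is left.\<close>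

lemma extremal_seq_nonneg:
  assumes "\<alpha> \<ge> 0 \<or> n = 1" "k \<ge> 1"
  shows "0 \<le> extremal_seq \<alpha> 0 n k"
proof -
  have "extremal_tail \<alpha> 0 n (k + 1) \<le> extremal_tail \<alpha> 0 n k"
    using assms by (auto simp: extremal_tail_def intro: powr_mono2')
  then show ?thesis by (simp add: extremal_seq_def)
qed

lemma cesaro_extremal_seq:
  assumes "n \<ge> 1"
  shows "cesaro (extremal_seq \<alpha> s n) n * real n powr \<alpha>
      = power_riemann_sum \<alpha> n + s * (real n / real (n + 1)) powr \<alpha>"
proof -
  have "(\<Sum>k=1..n. copson (extremal_seq \<alpha> s n) k) = (\<Sum>k=1..n. 1 * real k powr (- \<alpha>))"
    by (rule sum.cong) (auto simp: copson_extremal_seq extremal_tail_def)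
  moreover have "copson (extremal_seq \<alpha> s n) (n + 1) = - s * real (n + 1) powr (- \<alpha>)"
    by (simp add: copson_extremal_seq extremal_tail_def)
  ultimately have "cesaro (extremal_seq \<alpha> s n) n * real n powr \<alpha>
      = (\<Sum>k=1..n. 1 * real k powr (- \<alpha>)) / real n * real n powr \<alpha>
        + s * real (n + 1) powr (- \<alpha>) * real n powr \<alpha>"
    using cesaro_eq_mean_copson [OF extremal_seq_domain assms, of \<alpha> s n]
    by (simp add: distrib_right)
  also have "\<dots> = power_riemann_sum \<alpha> n + s * (real n / real (n + 1)) powr \<alpha>"
    unfolding mean_times_powr [OF assms] by (simp add: powr_divide powr_minus_divide)
  finally show ?thesis .
qed

text \<open>The extremal sequence has weighted Copson supremum at most 1, so its weighted Cesaro mean at \<open>n\<close>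
  is a lower bound for every admissible constant.\<close>

lemma extremal_lower_bound:
  assumes B: "cesaro_copson_bound S \<alpha> B" and S: "extremal_seq \<alpha> s n \<in> S"
    and s: "0 \<le> s" "s \<le> 1" and n: "n \<ge> 1"
  shows "ennreal (power_riemann_sum \<alpha> n + s * (real n / real (n + 1)) powr \<alpha>) \<le> B"
proof -
  let ?x = "extremal_seq \<alpha> s n"
  have "weighted_sup \<alpha> (copson ?x) \<le> ennreal 1"
    using s by (subst weighted_sup_le_ennreal_iff)
      (auto simp: copson_extremal_seq extremal_tail_def abs_mult powr_add [symmetric] mult.assoc)
  then have le: "B * weighted_sup \<alpha> (copson ?x) \<le> B * 1"
    by (intro mult_left_mono) auto
  have "ennreal (power_riemann_sum \<alpha> n + s * (real n / real (n + 1)) powr \<alpha>)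
      \<le> ennreal (\<bar>cesaro ?x n\<bar> * real n powr \<alpha>)"
    unfolding cesaro_extremal_seq [OF n, symmetric] by (intro ennreal_leI mult_right_mono) auto
  also note weighted_sup_ge [OF n, of "cesaro ?x" \<alpha>]
  also have "weighted_sup \<alpha> (cesaro ?x) \<le> B * weighted_sup \<alpha> (copson ?x)"
    using B S by (auto simp: cesaro_copson_bound_def)
  also note le
  finally show ?thesis by simp
qed

lemma extremal_lower_bound_limit:
  assumes \<alpha>: "0 < \<alpha>" "\<alpha> < 1" and s: "0 \<le> s" "s \<le> 1"
    and B: "cesaro_copson_bound S \<alpha> B" and S: "\<And>n. n \<ge> 1 \<Longrightarrow> extremal_seq \<alpha> s n \<in> S"
  shows "ennreal (1 / (1 - \<alpha>) + s) \<le> B"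
proof (rule tendsto_upperbound)
  have "(\<lambda>n. real n / real (n + 1)) \<longlonglongrightarrow> 1"
    using LIMSEQ_n_over_Suc_n by simp
  then have "(\<lambda>n. power_riemann_sum \<alpha> n + s * (real n / real (n + 1)) powr \<alpha>)
      \<longlonglongrightarrow> 1 / (1 - \<alpha>) + s * 1 powr \<alpha>"
    by (intro tendsto_intros power_riemann_sum_tendsto \<alpha>) auto
  then show "(\<lambda>n. ennreal (power_riemann_sum \<alpha> n + s * (real n / real (n + 1)) powr \<alpha>))
      \<longlonglongrightarrow> ennreal (1 / (1 - \<alpha>) + s)"
    by (intro tendsto_ennrealI) simp
  show "\<forall>\<^sub>F n in sequentially.
      ennreal (power_riemann_sum \<alpha> n + s * (real n / real (n + 1)) powr \<alpha>) \<le> B"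
    using eventually_ge_at_top [of 1]
    by eventually_elim (intro extremal_lower_bound [OF B] S s)
qed simp

lemma extremal_lower_bound_infinite:
  assumes \<alpha>: "\<alpha> \<ge> 1" and B: "cesaro_copson_bound S \<alpha> B"
    and S: "\<And>n. n \<ge> 1 \<Longrightarrow> extremal_seq \<alpha> 0 n \<in> S"
  shows "B = \<infinity>"
proof (cases B)
  case (real b)
  obtain n where n: "n \<ge> 1" "power_riemann_sum \<alpha> n > b"
    using power_riemann_sum_unbounded [OF \<alpha>] by blast
  have "ennreal (power_riemann_sum \<alpha> n) \<le> ennreal b"
    using extremal_lower_bound [OF B S [OF n(1)] _ _ n(1)] real by simp
  then show ?thesis using n(2) real(1) by simp
qed simp

theorem theorem4p2:
  fixes \<alpha> :: real
  shows "best_cesaro_copson_bound copson_domain \<alpha>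
           (if \<alpha> \<le> 0 then ennreal (1 + 2 powr (- \<alpha>))
            else if \<alpha> < 1 then ennreal ((2 - \<alpha>) / (1 - \<alpha>))
            else \<infinity>)
       \<and> best_cesaro_copson_bound {x \<in> copson_domain. \<forall>k\<ge>1. 0 \<le> x k} \<alpha>
           (if \<alpha> \<le> 0 then 1
            else if \<alpha> < 1 then ennreal (1 / (1 - \<alpha>))
            else \<infinity>)"
proof -
  let ?P = "{x \<in> copson_domain. \<forall>k\<ge>1. 0 \<le> x k}"
  have P: "extremal_seq \<alpha> 0 n \<in> ?P" if "\<alpha> \<ge> 0 \<or> n = 1" for n
    using that extremal_seq_domain extremal_seq_nonneg by blast
  consider "\<alpha> \<le> 0" | "0 < \<alpha>" "\<alpha> < 1" | "\<alpha> \<ge> 1" by linarith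
  then show ?thesis
  proof cases
    case 1
    have one: "power_riemann_sum \<alpha> 1 = 1" by (simp add: power_riemann_sum_def)
    have half: "(1 / 2) powr \<alpha> = 2 powr (- \<alpha>)" by (simp add: powr_divide powr_minus_divide)
    have "cesaro_copson_bound copson_domain \<alpha> (ennreal (1 + 2 powr (- \<alpha>)))"
    proof (rule cesaro_copson_boundI)
      fix x M and n :: nat
      assume *: "x \<in> copson_domain" "M \<ge> 0" "n \<ge> 1"
        "\<And>k. k \<ge> 1 \<Longrightarrow> \<bar>copson x k\<bar> \<le> M * real k powr (- \<alpha>)"
      note abs_cesaro_le [OF *(1,3,4)]
      also have "M * (power_riemann_sum \<alpha> n + (real n / real (n + 1)) powr \<alpha>)
          \<le> M * (1 + 2 powr (- \<alpha>))"
        using * 1 by (intro mult_left_mono add_mono power_riemann_sum_le_1 shifted_ratio_powr_le)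
      finally show "\<bar>cesaro x n\<bar> * real n powr \<alpha> \<le> (1 + 2 powr (- \<alpha>)) * M"
        by (simp add: mult.commute)
    qed (simp add: add_pos_nonneg)
    moreover have "ennreal (1 + 2 powr (- \<alpha>)) \<le> B" if "cesaro_copson_bound copson_domain \<alpha> B" for B
      using extremal_lower_bound [OF that extremal_seq_domain, of 1 1] one half by simp
    moreover have "cesaro_copson_bound ?P \<alpha> (ennreal 1)"
    proof (rule cesaro_copson_boundI)
      fix x M and n :: nat
      assume *: "x \<in> ?P" "M \<ge> 0" "n \<ge> 1"
        "\<And>k. k \<ge> 1 \<Longrightarrow> \<bar>copson x k\<bar> \<le> M * real k powr (- \<alpha>)"
      have "\<bar>cesaro x n\<bar> * real n powr \<alpha> \<le> M * power_riemann_sum \<alpha> n"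
        using * by (intro abs_cesaro_le_nonneg) auto
      also have "\<dots> \<le> M * 1"
        using * 1 by (intro mult_left_mono power_riemann_sum_le_1)
      finally show "\<bar>cesaro x n\<bar> * real n powr \<alpha> \<le> 1 * M" by simp
    qed simp
    moreover have "1 \<le> B" if "cesaro_copson_bound ?P \<alpha> B" for B
      using extremal_lower_bound [OF that P, of 1] one by simp
    ultimately show ?thesis using 1 by (simp add: best_cesaro_copson_bound_def)
  next
    case 2
    have const: "(2 - \<alpha>) / (1 - \<alpha>) = 1 / (1 - \<alpha>) + 1" using 2 by (simp add: field_simps)
    have "cesaro_copson_bound copson_domain \<alpha> (ennreal ((2 - \<alpha>) / (1 - \<alpha>)))"
    proof (rule cesaro_copson_boundI)
      fix x M and n :: nat
      assume *: "x \<in> copson_domain" "M \<ge> 0" "n \<ge> 1"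
        "\<And>k. k \<ge> 1 \<Longrightarrow> \<bar>copson x k\<bar> \<le> M * real k powr (- \<alpha>)"
      note abs_cesaro_le [OF *(1,3,4)]
      also have "M * (power_riemann_sum \<alpha> n + (real n / real (n + 1)) powr \<alpha>)
          \<le> M * (1 / (1 - \<alpha>) + 1)"
        using * 2 by (intro mult_left_mono add_mono power_riemann_sum_le shifted_ratio_powr_le) auto
      finally show "\<bar>cesaro x n\<bar> * real n powr \<alpha> \<le> (2 - \<alpha>) / (1 - \<alpha>) * M"
        unfolding const by (simp add: mult.commute)
    qed (use 2 in simp)
    moreover have "ennreal ((2 - \<alpha>) / (1 - \<alpha>)) \<le> B" if "cesaro_copson_bound copson_domain \<alpha> B" for B
      unfolding const
      by (rule extremal_lower_bound_limit [OF 2 _ _ that]) (auto simp: extremal_seq_domain)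
    moreover have "cesaro_copson_bound ?P \<alpha> (ennreal (1 / (1 - \<alpha>)))"
    proof (rule cesaro_copson_boundI)
      fix x M and n :: nat
      assume *: "x \<in> ?P" "M \<ge> 0" "n \<ge> 1"
        "\<And>k. k \<ge> 1 \<Longrightarrow> \<bar>copson x k\<bar> \<le> M * real k powr (- \<alpha>)"
      have "\<bar>cesaro x n\<bar> * real n powr \<alpha> \<le> M * power_riemann_sum \<alpha> n"
        using * by (intro abs_cesaro_le_nonneg) auto
      also have "\<dots> \<le> M * (1 / (1 - \<alpha>))"
        using * 2 by (intro mult_left_mono power_riemann_sum_le)
      finally show "\<bar>cesaro x n\<bar> * real n powr \<alpha> \<le> 1 / (1 - \<alpha>) * M" by simp
    qed (use 2 in simp)
    moreover have "ennreal (1 / (1 - \<alpha>)) \<le> B" if "cesaro_copson_bound ?P \<alpha> B" for B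
      using extremal_lower_bound_limit [OF 2 _ _ that P] 2 by simp
    ultimately show ?thesis using 2 by (simp add: best_cesaro_copson_bound_def)
  next
    case 3
    have "cesaro_copson_bound copson_domain \<alpha> \<infinity>" "cesaro_copson_bound ?P \<alpha> \<infinity>"
      by (rule cesaro_copson_bound_infinity, blast)+
    moreover have "\<infinity> \<le> B" if "cesaro_copson_bound copson_domain \<alpha> B" for B
      using extremal_lower_bound_infinite [OF 3 that] by (simp add: extremal_seq_domain)
    moreover have "\<infinity> \<le> B" if "cesaro_copson_bound ?P \<alpha> B" for B
      using extremal_lower_bound_infinite [OF 3 that P] 3 by simp
    ultimately show ?thesis using 3 by (simp add: best_cesaro_copson_bound_def)
  qed
qed

end
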